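(* Let $d$ be a degree sequence and let $t$ be a positive integer. Then $d$ is $t$-tot-bigraphic if and only if there exists a balanced partition $(a,b)\in \mathrm{BP}(d)$ such that the pair $(a\circ(1^t),\, b\circ(1^t))$ is bigraphic.
   Context: A degree sequence is a non-increasing sequence $d=(d_1,\dots,d_n)$ of positive integers with even sum $\sum d=\sum_i d_i$. All multigraphs are loopless (parallel edges allowed, self-loops not). For a multigraph $H=(V,E)$ ($E$ a multiset), the underlying graph is the simple graph obtained by keeping one copy of each edge; $\mathrm{TotMult}(H)=|E|-|E'|$ where $E'$ is the edge set of the underlying graph (the total number of excess edge copies). A multigraph is bipartite if its underlying graph is bipartite. $d$ is $t$-tot-bigraphic if there is a bipartite multigraph $H$ whose degree sequence is $d$ and $\mathrm{TotMult}(H)\le t$. A block of $d$ is a subsequence of total sum $\sum d/2$; $\mathrm{BP}(d)$ is the set of pairs $\{a,b\}$ of complementary blocks with $a\circ b=d$, where $\circ$ denotes concatenation (re-sorted in non-increasing order) and $1^t$ denotes $t$ entries equal to $1$. A pair $(a,b)$ is bigraphic if there is a simple bipartite graph $G=(A,B,E)$ in which the degree sequence of the vertices of $A$ is $a$ and that of $B$ is $b$. *)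

theory Defs
  imports Main "HOL-Library.Multiset" "HOL-Library.Sublist"
begin

definition degree_sequence :: "nat list \<Rightarrow> bool" where
  "degree_sequence d \<longleftrightarrow>
     sorted_wrt (\<ge>) d \<and> (\<forall>x\<in>set d. 0 < x) \<and> even (sum_list d)"

definition desc_list :: "nat multiset \<Rightarrow> nat list" where
  "desc_list M = rev (sorted_list_of_multiset M)"

definition seq_comp :: "nat list \<Rightarrow> nat list \<Rightarrow> nat list"  (infixr \<open>\<odot>\<close> 65) where
  "a \<odot> b = desc_list (mset (a @ b))"


definition simple_graph :: "'v set \<Rightarrow> 'v set set \<Rightarrow> bool" where
  "simple_graph V E \<longleftrightarrow> finite V \<and> (\<forall>e\<in>E. e \<subseteq> V \<and> card e = 2)"

definition simple_degree :: "'v set set \<Rightarrow> 'v \<Rightarrow> nat" where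
  "simple_degree E v = card {e \<in> E. v \<in> e}"

definition bipartite_with :: "'v set \<Rightarrow> 'v set \<Rightarrow> 'v set set \<Rightarrow> bool" where
  "bipartite_with A B E \<longleftrightarrow>
     simple_graph (A \<union> B) E \<and> A \<inter> B = {} \<and> (\<forall>e\<in>E. \<exists>u\<in>A. \<exists>v\<in>B. e = {u, v})"

definition bipartite :: "'v set \<Rightarrow> 'v set set \<Rightarrow> bool" where
  "bipartite V E \<longleftrightarrow> (\<exists>A B. V = A \<union> B \<and> bipartite_with A B E)"


text \<open>A loopless multigraph is a finite vertex set with a multiset of two-element vertex sets, so
  its underlying simple graph has edge set \<^term>\<open>set_mset E\<close>.\<close>

definition multigraph :: "'v set \<Rightarrow> 'v set multiset \<Rightarrow> bool" where
  "multigraph V E \<longleftrightarrow> finite V \<and> (\<forall>e\<in>#E. e \<subseteq> V \<and> card e = 2)"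

definition multi_degree :: "'v set multiset \<Rightarrow> 'v \<Rightarrow> nat" where
  "multi_degree E v = size {#e \<in># E. v \<in> e#}"

definition underlying_edges :: "'v set multiset \<Rightarrow> 'v set set" where
  "underlying_edges E = set_mset E"

definition bipartite_multigraph :: "'v set \<Rightarrow> 'v set multiset \<Rightarrow> bool" where
  "bipartite_multigraph V E \<longleftrightarrow> multigraph V E \<and> bipartite V (underlying_edges E)"

text \<open>The subtraction never truncates, as a multiset has at most \<^term>\<open>size E\<close> distinct elements.\<close>

definition TotMult :: "'v set multiset \<Rightarrow> nat" where
  "TotMult E = size E - card (underlying_edges E)"

definition degrees_on :: "('v \<Rightarrow> nat) \<Rightarrow> 'v set \<Rightarrow> nat list" where
  "degrees_on deg V = desc_list (image_mset deg (mset_set V))"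


text \<open>Graphs are finite, so taking natural numbers as vertices loses no generality in the two
  existential definitions below.\<close>

definition tot_bigraphic :: "nat \<Rightarrow> nat list \<Rightarrow> bool" where
  "tot_bigraphic t d \<longleftrightarrow>
     (\<exists>(V :: nat set) E. bipartite_multigraph V E \<and>
        degrees_on (multi_degree E) V = d \<and> TotMult E \<le> t)"

definition bigraphic :: "nat list \<Rightarrow> nat list \<Rightarrow> bool" where
  "bigraphic a b \<longleftrightarrow>
     (\<exists>(A :: nat set) B E. bipartite_with A B E \<and>
        degrees_on (simple_degree E) A = a \<and> degrees_on (simple_degree E) B = b)"


definition block :: "nat list \<Rightarrow> nat list \<Rightarrow> bool" where
  "block d a \<longleftrightarrow> subseq a d \<and> 2 * sum_list a = sum_list d"

text \<open>Unordered pairs are sets \<open>{a, b}\<close>; the case \<open>a = b\<close> gives a singleton.\<close>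

definition BP :: "nat list \<Rightarrow> nat list set set" where
  "BP d = {{a, b} | a b. block d a \<and> block d b \<and> a \<odot> b = d}"

end

theory Submission imports Defs begin

text \<open>
  A bipartite multigraph is a multiset of pairs. Trading one excess copy of an edge \<open>uv\<close> for two
  edges \<open>uy\<close> and \<open>xv\<close> with new endpoints \<open>x\<close>, \<open>y\<close> lowers the total multiplicity by one and adds one
  vertex of degree one to each side. Conversely, two vertices \<open>x\<close>, \<open>y\<close> of degree one on opposite
  sides can be removed by splicing their edges \<open>uy\<close>, \<open>xv\<close> into one edge \<open>uv\<close>, which raises the total
  multiplicity by at most one. If there is no excess copy left, or if \<open>x\<close> and \<open>y\<close> are adjacent, the
  edge \<open>xy\<close> is added or removed instead. So \<open>(a, b)\<close> is realizable with total multiplicity at most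
  \<open>t\<close> iff \<open>(a \<circ> 1\<^sup>t, b \<circ> 1\<^sup>t)\<close> is realizable with total multiplicity \<open>0\<close>.
\<close>

section \<open>Sorted lists and multisets\<close>

lemma mset_desc_list [simp]: "mset (desc_list M) = M"
  by (simp add: desc_list_def)

lemma sorted_desc_list: "sorted_wrt (\<ge>) (desc_list M)"
  by (simp add: desc_list_def sorted_wrt_rev)

lemma desc_list_mset:
  assumes "sorted_wrt (\<ge>) d"
  shows "desc_list (mset d) = d"
proof -
  have "sorted (rev d)"
    using assms by (simp add: sorted_wrt_rev)
  then have "sorted_list_of_multiset (mset (rev d)) = rev d"
    by (simp only: sorted_list_of_multiset_mset sorted_sort_id)
  then show ?thesis
    by (simp add: desc_list_def)
qed

lemma desc_list_eq_iff: "sorted_wrt (\<ge>) d \<Longrightarrow> desc_list M = d \<longleftrightarrow> M = mset d"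
  using desc_list_mset by fastforce

lemma mset_seq_comp [simp]: "mset (a \<odot> b) = mset a + mset b"
  by (simp add: seq_comp_def)

lemma sorted_seq_comp: "sorted_wrt (\<ge>) (a \<odot> b)"
  by (simp add: seq_comp_def sorted_desc_list)

text \<open>Blocks are subsequences, while degrees are handled below as multisets. In the induction,
  if the heads differ then \<open>y\<close> exceeds every entry of \<open>xs\<close>, so it can be
  skipped.\<close>

lemma subseq_if_mset_subseteq_sorted:
  fixes xs ys :: "'a::linorder list"
  assumes "sorted_wrt (\<ge>) xs" "sorted_wrt (\<ge>) ys" "mset xs \<subseteq># mset ys"
  shows "subseq xs ys"
  using assms
proof (induction ys arbitrary: xs)
  case Nil
  then show ?case by simp
next
  case (Cons y ys)
  show ?case
  proof (cases xs)
    case Nil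
    then show ?thesis by simp
  next
    case (Cons x xs')
    show ?thesis
    proof (cases "x = y")
      case True
      then show ?thesis
        using Cons.IH[of xs'] Cons.prems \<open>xs = x # xs'\<close> by simp
    next
      case False
      have "x \<in># mset (y # ys)"
        using Cons.prems(3) \<open>xs = x # xs'\<close> by (meson list.set_intros(1) mset_subset_eqD set_mset_mset in_multiset_in_set)
      then have "x < y"
        using Cons.prems(2) False by auto
      then have "y \<notin># mset xs"
        using Cons.prems(1) \<open>xs = x # xs'\<close> by auto
      then have "mset xs \<subseteq># mset ys"
        using Cons.prems(3) by (metis diff_single_trivial mset.simps(2) subset_eq_diff_conv add_mset_add_single)
      then show ?thesis
        using Cons.IH[of xs] Cons.prems by auto
    qed
  qed
qed

section \<open>Degrees and excess of multisets of pairs\<close>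

text \<open>\<open>N\<close> is meant to hold one endpoint in \<open>A\<close> per edge copy, so
  that \<open>count N\<close> is the degree; isolated vertices contribute 0.\<close>

definition degs :: "'a set \<Rightarrow> 'a multiset \<Rightarrow> nat multiset" where
  "degs A N = image_mset (count N) (mset_set A)"

definition excess :: "'a multiset \<Rightarrow> nat" where
  "excess M = size M - card (set_mset M)"

lemma card_set_mset_le_size: "card (set_mset M) \<le> size M"
  by (induction M) (auto simp: card_insert_if)

lemma excess_add_mset: "excess (add_mset p M) = (if p \<in># M then Suc (excess M) else excess M)"
  using card_set_mset_le_size[of M] by (auto simp: excess_def insert_absorb card_insert_if)

lemma excess_image_mset_inj:
  assumes "inj_on f (set_mset M)"
  shows "excess (image_mset f M) = excess M"
  using assms by (simp add: excess_def card_image)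

text \<open>This is how simple graphs are recovered: excess 0 means that no element is
  repeated.\<close>

lemma excess_0_conv: "excess M = 0 \<longleftrightarrow> M = mset_set (set_mset M)"
proof
  show "excess M = 0 \<Longrightarrow> M = mset_set (set_mset M)"
    by (induction M) (auto simp: excess_add_mset split: if_splits)
  show "M = mset_set (set_mset M) \<Longrightarrow> excess M = 0"
    by (metis excess_def size_mset_set diff_self_eq_0)
qed

lemma excess_pos_obtain:
  assumes "0 < excess M"
  obtains p M' where "M = add_mset p M'" "p \<in># M'"
proof -
  have "\<exists>p M'. M = add_mset p M' \<and> p \<in># M'"
    using assms
  proof (induction M)
    case empty
    then show ?case by (simp add: excess_def)
  next
    case (add q M)
    then show ?case
      by (metis excess_add_mset add_mset_commute union_single_eq_member insert_iff set_mset_add_mset_insert)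
  qed
  then show ?thesis using that by blast
qed

text \<open>Handshake count on one side: every edge copy has exactly one endpoint in
  \<open>A\<close>.\<close>

lemma sum_degs:
  assumes "finite A" "set_mset N \<subseteq> A"
  shows "sum_mset (degs A N) = size N"
proof -
  have "sum_mset (degs A N) = sum (count N) A"
    by (simp add: degs_def sum_unfold_sum_mset)
  also have "\<dots> = sum (count N) (set_mset N)"
    using assms by (intro sum.mono_neutral_right) (auto simp: not_in_iff)
  finally show ?thesis
    by (simp add: size_multiset_overloaded_eq)
qed

lemma degs_insert:
  assumes "finite A" "set_mset N \<subseteq> A" "x \<notin> A"
  shows "degs (insert x A) (add_mset x N) = add_mset 1 (degs A N)"
proof -
  have "count N x = 0"
    using assms by (meson not_in_iff subsetD)
  moreover have "image_mset (count (add_mset x N)) (mset_set A) = image_mset (count N) (mset_set A)"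
    using assms by (intro image_mset_cong) auto
  ultimately show ?thesis
    using assms by (simp add: degs_def)
qed

text \<open>An entry 1 comes from some \<open>x\<close> that occurs once in \<open>N\<close>;
  deleting it changes no other count, so \<open>degs_insert\<close> can be reversed.\<close>

lemma degs_remove:
  assumes "finite A" "set_mset N \<subseteq> A" "degs A N = add_mset 1 l"
  obtains x N' where "x \<in> A" "N = add_mset x N'" "set_mset N' \<subseteq> A - {x}" "degs (A - {x}) N' = l"
proof -
  have "1 \<in># degs A N"
    using assms by simp
  then obtain x where x: "x \<in> A" "count N x = 1"
    using assms(1) by (auto simp: degs_def)
  define N' where "N' = N - {#x#}"
  have N: "N = add_mset x N'"
    using x by (simp add: N'_def flip: count_greater_zero_iff)
  have sub: "set_mset N' \<subseteq> A - {x}"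
    using x assms(2) unfolding N by (auto simp: count_eq_zero_iff)
  have "degs A N = add_mset 1 (degs (A - {x}) N')"
    using degs_insert[of "A - {x}" N' x] sub x assms(1) by (simp add: N insert_absorb)
  then show ?thesis
    using that x N sub assms(3) by simp
qed

section \<open>Realizable pairs of degree multisets\<close>

text \<open>Edges are ordered pairs with the endpoint in \<open>A\<close> first. Degrees then depend
  only on the two projections of \<open>M\<close>, so re-pairing endpoints keeps them.\<close>

definition realizes :: "'v set \<Rightarrow> 'v set \<Rightarrow> ('v \<times> 'v) multiset \<Rightarrow> nat multiset \<Rightarrow> nat multiset \<Rightarrow> bool" where
  "realizes A B M l r \<longleftrightarrow> finite A \<and> finite B \<and> A \<inter> B = {} \<and> set_mset M \<subseteq> A \<times> B \<and>
     degs A (image_mset fst M) = l \<and> degs B (image_mset snd M) = r"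

definition realizable :: "nat \<Rightarrow> nat multiset \<Rightarrow> nat multiset \<Rightarrow> bool" where
  "realizable k l r \<longleftrightarrow> (\<exists>(A :: nat set) B M. realizes A B M l r \<and> excess M \<le> k)"

lemma realizes_fst_snd:
  assumes "realizes A B M l r"
  shows "set_mset (image_mset fst M) \<subseteq> A" "set_mset (image_mset snd M) \<subseteq> B"
  using assms by (auto simp: realizes_def)

text \<open>Both sums count the edge copies.\<close>

lemma realizable_sums_eq:
  assumes "realizable k l r"
  shows "sum_mset l = sum_mset r"
proof -
  obtain A B :: "nat set" and M where R: "realizes A B M l r"
    using assms by (auto simp: realizable_def)
  then show ?thesis
    using sum_degs[of A "image_mset fst M"] sum_degs[of B "image_mset snd M"] realizes_fst_snd[OF R]
    by (auto simp: realizes_def)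
qed

lemma realizable_add_ones:
  assumes "realizable (Suc k) l r"
  shows "realizable k (add_mset 1 l) (add_mset 1 r)"
proof -
  obtain A B :: "nat set" and M where R: "realizes A B M l r" and k: "excess M \<le> Suc k"
    using assms by (auto simp: realizable_def)
  then have fin: "finite A" "finite B" and disj: "A \<inter> B = {}" and M: "set_mset M \<subseteq> A \<times> B"
    and l: "degs A (image_mset fst M) = l" and r: "degs B (image_mset snd M) = r"
    by (auto simp: realizes_def)
  obtain x where x: "x \<notin> A \<union> B"
    using ex_new_if_finite[of "A \<union> B"] fin by auto
  obtain y where y: "y \<notin> insert x (A \<union> B)"
    using ex_new_if_finite[of "insert x (A \<union> B)"] fin by auto
  \<comment> \<open>Only the projections matter for the degrees, so each case below has to supply
    just an \<open>M'\<close> with the right projections and small excess.\<close>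
  have goal: "realizable k (add_mset 1 l) (add_mset 1 r)"
    if M': "set_mset M' \<subseteq> insert x A \<times> insert y B" "excess M' \<le> k"
      "image_mset fst M' = add_mset x (image_mset fst M)"
      "image_mset snd M' = add_mset y (image_mset snd M)" for M'
  proof -
    have "realizes (insert x A) (insert y B) M' (add_mset 1 l) (add_mset 1 r)"
      unfolding realizes_def M'(3,4)
      using fin disj x y M'(1) l r realizes_fst_snd[OF R]
        degs_insert[of A "image_mset fst M" x] degs_insert[of B "image_mset snd M" y]
      by simp
    with M'(2) show ?thesis
      unfolding realizable_def by blast
  qed
  show ?thesis
  proof (cases "excess M = 0")
    case True
    \<comment> \<open>Without excess, the new edge \<open>(x, y)\<close> alone supplies both degrees
      1 and keeps the excess at 0.\<close>
    have "(x, y) \<notin># M"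
      using M x by auto
    with True show ?thesis
      using M by (intro goal[of "add_mset (x, y) M"]) (auto simp: excess_add_mset)
  next
    case False
    then obtain p M' where "M = add_mset p M'" "p \<in># M'"
      using excess_pos_obtain by blast
    then obtain u v where uv: "M = add_mset (u, v) M'" "(u, v) \<in># M'"
      by (cases p) auto
    \<comment> \<open>A copy of \<open>(u, v)\<close> is left in \<open>M'\<close>, so taking the
      other one away lowers the excess by 1. Both replacement edges have a new endpoint and hence
      repeat nothing.\<close>
    have "(u, y) \<notin># M'" "(x, v) \<notin># add_mset (u, y) M'"
      using M x y uv by auto
    then have "excess (add_mset (x, v) (add_mset (u, y) M')) \<le> k"
      using k uv by (auto simp: excess_add_mset)
    then show ?thesis
      using M uv by (intro goal[of "add_mset (x, v) (add_mset (u, y) M')"]) auto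
  qed
qed

lemma realizable_remove_ones:
  assumes "realizable k (add_mset 1 l) (add_mset 1 r)"
  shows "realizable (Suc k) l r"
proof -
  obtain A B :: "nat set" and M
    where R: "realizes A B M (add_mset 1 l) (add_mset 1 r)" and k: "excess M \<le> k"
    using assms by (auto simp: realizable_def)
  then have fin: "finite A" "finite B" and disj: "A \<inter> B = {}" and M: "set_mset M \<subseteq> A \<times> B"
    and l: "degs A (image_mset fst M) = add_mset 1 l"
    and r: "degs B (image_mset snd M) = add_mset 1 r"
    by (auto simp: realizes_def)
  obtain x F where x: "x \<in> A" "image_mset fst M = add_mset x F" "set_mset F \<subseteq> A - {x}"
      "degs (A - {x}) F = l"
    using degs_remove[OF fin(1) realizes_fst_snd(1)[OF R] l] by blast
  obtain y S where y: "y \<in> B" "image_mset snd M = add_mset y S" "set_mset S \<subseteq> B - {y}"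
      "degs (B - {y}) S = r"
    using degs_remove[OF fin(2) realizes_fst_snd(2)[OF R] r] by blast
  \<comment> \<open>Again the projections suffice: \<open>F\<close> avoids \<open>x\<close> and
    \<open>S\<close> avoids \<open>y\<close>, hence so do the pairs of \<open>M'\<close>.\<close>
  have goal: "realizable (Suc k) l r"
    if M': "excess M' \<le> Suc k" "image_mset fst M' = F" "image_mset snd M' = S" for M'
  proof -
    have "set_mset M' \<subseteq> set_mset (image_mset fst M') \<times> set_mset (image_mset snd M')"
      by force
    then have "set_mset M' \<subseteq> (A - {x}) \<times> (B - {y})"
      unfolding M'(2,3) using x(3) y(3) by blast
    then have "realizes (A - {x}) (B - {y}) M' l r"
      using M' fin disj x(4) y(4) by (auto simp: realizes_def)
    with M'(1) show ?thesis
      unfolding realizable_def by blast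
  qed
  show ?thesis
  proof (cases "(x, y) \<in># M")
    case True
    \<comment> \<open>Here \<open>(x, y)\<close> is the only edge at \<open>x\<close> and at
      \<open>y\<close>; deleting it does not raise the excess.\<close>
    then obtain M' where M': "M = add_mset (x, y) M'"
      by (metis mset_add)
    then show ?thesis
      using k x(2) y(2) by (intro goal[of M']) (auto simp: excess_add_mset split: if_splits)
  next
    case False
    have "x \<in># image_mset fst M" "y \<in># image_mset snd M"
      using x y by simp_all
    then obtain u v where uv: "(x, v) \<in># M" "(u, y) \<in># M"
      by auto
    then obtain M1 where M1: "M = add_mset (x, v) M1"
      by (metis mset_add)
    \<comment> \<open>This copy survives the removal of \<open>(x, v)\<close>: if the two pairs were
      equal, \<open>(x, y)\<close> would lie in \<open>M\<close>.\<close>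
    have "(u, y) \<in># M1"
      using uv False unfolding M1 by auto
    then obtain M2 where M2: "M = add_mset (x, v) (add_mset (u, y) M2)"
      unfolding M1 by (metis mset_add)
    \<comment> \<open>The spliced edge \<open>(u, v)\<close> may already lie in \<open>M2\<close>,
      which accounts for the possible gain of 1 in excess.\<close>
    show ?thesis
      using k x(2) y(2) unfolding M2
      by (intro goal[of "add_mset (u, v) M2"]) (auto simp: excess_add_mset split: if_splits)
  qed
qed

text \<open>Each unit of allowed excess is traded for one further 1 on each side, until none is
  left; the degrees change on the way, so the induction keeps \<open>l\<close> and \<open>r\<close>
  arbitrary.\<close>

lemma realizable_iff_ones:
  "realizable t l r \<longleftrightarrow> realizable 0 (l + replicate_mset t 1) (r + replicate_mset t 1)"
proof (induction t arbitrary: l r)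
  case 0
  then show ?case by simp
next
  case (Suc t)
  have "realizable (Suc t) l r \<longleftrightarrow> realizable t (add_mset 1 l) (add_mset 1 r)"
    using realizable_add_ones realizable_remove_ones by blast
  then show ?case
    by (simp add: Suc.IH)
qed

section \<open>Two-element sets as edges\<close>

definition edge :: "'v \<times> 'v \<Rightarrow> 'v set" where
  "edge p = {fst p, snd p}"

text \<open>Disjointness lets the order of a pair be read off from its set.\<close>

lemma inj_on_edge: "A \<inter> B = {} \<Longrightarrow> inj_on edge (A \<times> B)"
  by (auto simp: inj_on_def edge_def doubleton_eq_iff)

text \<open>By disjointness, a vertex of \<open>A\<close> can lie in \<open>edge p\<close> only as
  \<open>fst p\<close>, and a vertex of \<open>B\<close> only as \<open>snd p\<close>.\<close>

lemma multi_degree_edges: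
  assumes "A \<inter> B = {}" "set_mset M \<subseteq> A \<times> B"
  shows "u \<in> A \<Longrightarrow> multi_degree (image_mset edge M) u = count (image_mset fst M) u"
    and "v \<in> B \<Longrightarrow> multi_degree (image_mset edge M) v = count (image_mset snd M) v"
  using assms(2)
proof (induction M)
  case empty
  {
    case 1 then show ?case by (simp add: multi_degree_def)
  next
    case 2 then show ?case by (simp add: multi_degree_def)
  }
next
  case (add p M)
  {
    case 1 then show ?case using add assms(1) by (auto simp: multi_degree_def edge_def)
  next
    case 2 then show ?case using add assms(1) by (auto simp: multi_degree_def edge_def)
  }
qed

lemma image_multi_degree:
  assumes "finite A" "finite B" "A \<inter> B = {}" "set_mset M \<subseteq> A \<times> B"
  shows "image_mset (multi_degree (image_mset edge M)) (mset_set A) = degs A (image_mset fst M)"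
    and "image_mset (multi_degree (image_mset edge M)) (mset_set B) = degs B (image_mset snd M)"
  unfolding degs_def using assms
  by (auto intro!: image_mset_cong simp: multi_degree_edges[OF assms(3,4)])

lemma multiset_of_edges_obtain:
  assumes "bipartite_with A B (set_mset E)"
  obtains M where "set_mset M \<subseteq> A \<times> B" "E = image_mset edge M"
proof -
  have sub: "set_mset E \<subseteq> edge ` (A \<times> B)"
  proof
    fix e
    assume "e \<in> set_mset E"
    then obtain u v where "u \<in> A" "v \<in> B" "e = {u, v}"
      using assms unfolding bipartite_with_def by blast
    then show "e \<in> edge ` (A \<times> B)"
      by (intro image_eqI[of _ _ "(u, v)"]) (simp_all add: edge_def)
  qed
  \<comment> \<open>The inverse of \<open>edge\<close> orients every edge copy from \<open>A\<close>
    to \<open>B\<close>.\<close>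
  define M where "M = image_mset (inv_into (A \<times> B) edge) E"
  have "image_mset edge M = image_mset id E"
    unfolding M_def multiset.map_comp
    using sub by (intro image_mset_cong) (auto intro!: f_inv_into_f)
  moreover have "set_mset M \<subseteq> A \<times> B"
    unfolding M_def set_image_mset using sub by (blast intro: inv_into_into)
  ultimately show ?thesis
    using that by simp
qed

lemma bipartite_with_edges:
  assumes "finite A" "finite B" "A \<inter> B = {}" "set_mset M \<subseteq> A \<times> B"
  shows "bipartite_with A B (set_mset (image_mset edge M))"
  unfolding bipartite_with_def simple_graph_def
proof (intro conjI ballI)
  fix e
  assume "e \<in> set_mset (image_mset edge M)"
  then obtain u v where e: "u \<in> A" "v \<in> B" "e = {u, v}"
    using assms(4) by (auto simp: edge_def)
  then show "e \<subseteq> A \<union> B" "\<exists>u\<in>A. \<exists>v\<in>B. e = {u, v}"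
    by auto
  show "card e = 2"
    using e assms(3) by (metis card_2_iff disjoint_iff)
qed (use assms in auto)

text \<open>Bridge from pairs to graphs: \<open>edge\<close> is injective on
  \<open>A \<times> B\<close>, so it preserves the excess in both directions.\<close>

lemma realizable_iff_bipartite_with:
  "realizable k l r \<longleftrightarrow> (\<exists>(A :: nat set) B E. bipartite_with A B (set_mset E) \<and> excess E \<le> k \<and>
     image_mset (multi_degree E) (mset_set A) = l \<and> image_mset (multi_degree E) (mset_set B) = r)"
    (is "_ \<longleftrightarrow> ?rhs")
proof
  assume "realizable k l r"
  then obtain A B :: "nat set" and M where R: "finite A" "finite B" "A \<inter> B = {}"
      "set_mset M \<subseteq> A \<times> B" "degs A (image_mset fst M) = l" "degs B (image_mset snd M) = r"
      and k: "excess M \<le> k"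
    unfolding realizable_def realizes_def by blast
  have "excess (image_mset edge M) \<le> k"
    using k R(4) inj_on_edge[OF R(3)] by (metis excess_image_mset_inj inj_on_subset)
  then show ?rhs
    using bipartite_with_edges[OF R(1-4)] image_multi_degree[OF R(1-4)] R(5,6) by blast
next
  assume ?rhs
  then obtain A B :: "nat set" and E where E: "bipartite_with A B (set_mset E)" "excess E \<le> k"
      "image_mset (multi_degree E) (mset_set A) = l" "image_mset (multi_degree E) (mset_set B) = r"
    by blast
  obtain M where M: "set_mset M \<subseteq> A \<times> B" "E = image_mset edge M"
    using multiset_of_edges_obtain[OF E(1)] .
  have AB: "finite A" "finite B" "A \<inter> B = {}"
    using E(1) by (auto simp: bipartite_with_def simple_graph_def)
  have "excess M \<le> k"
    using E(2) M inj_on_edge[OF AB(3)] by (metis excess_image_mset_inj inj_on_subset)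
  moreover have "realizes A B M l r"
    using AB M E(3,4) image_multi_degree[OF AB M(1)] by (simp add: realizes_def)
  ultimately show "realizable k l r"
    unfolding realizable_def by blast
qed

section \<open>Both graph notions in terms of realizability\<close>

lemma bipartite_with_finite_edges: "bipartite_with A B E \<Longrightarrow> finite E"
  unfolding bipartite_with_def simple_graph_def by (meson PowI finite_Pow_iff finite_subset subsetI)

lemma multi_degree_mset_set:
  assumes "finite E"
  shows "multi_degree (mset_set E) = simple_degree E"
  using assms by (auto simp: multi_degree_def simple_degree_def fun_eq_iff filter_mset_mset_set)

text \<open>A simple edge set is an edge multiset of excess 0. Sortedness lets degree lists be
  compared as multisets.\<close>

lemma bigraphic_iff_realizable:
  assumes "sorted_wrt (\<ge>) a" "sorted_wrt (\<ge>) b"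
  shows "bigraphic a b \<longleftrightarrow> realizable 0 (mset a) (mset b)"
proof
  assume "bigraphic a b"
  then obtain A B :: "nat set" and E where E: "bipartite_with A B E"
      "image_mset (simple_degree E) (mset_set A) = mset a"
      "image_mset (simple_degree E) (mset_set B) = mset b"
    unfolding bigraphic_def degrees_on_def desc_list_eq_iff[OF assms(1)] desc_list_eq_iff[OF assms(2)]
    by blast
  note fin = bipartite_with_finite_edges[OF E(1)]
  have "excess (mset_set E) \<le> 0"
    using fin by (simp add: excess_def)
  then show "realizable 0 (mset a) (mset b)"
    unfolding realizable_iff_bipartite_with
    using E fin multi_degree_mset_set[OF fin] by (metis finite_set_mset_mset_set)
next
  assume "realizable 0 (mset a) (mset b)"
  then obtain A B :: "nat set" and E where E: "bipartite_with A B (set_mset E)" "excess E = 0"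
      "image_mset (multi_degree E) (mset_set A) = mset a"
      "image_mset (multi_degree E) (mset_set B) = mset b"
    unfolding realizable_iff_bipartite_with by auto
  have "multi_degree E = simple_degree (set_mset E)"
    using E(2) multi_degree_mset_set[of "set_mset E"] by (simp add: excess_0_conv)
  then show "bigraphic a b"
    unfolding bigraphic_def degrees_on_def desc_list_eq_iff[OF assms(1)] desc_list_eq_iff[OF assms(2)]
    using E by auto
qed

text \<open>The two sides of a bipartition split the degrees into \<open>l\<close> and
  \<open>r\<close>; conversely, the union of the sides serves as \<open>V\<close>.\<close>

lemma tot_bigraphic_iff_realizable:
  assumes "sorted_wrt (\<ge>) d"
  shows "tot_bigraphic t d \<longleftrightarrow> (\<exists>l r. mset d = l + r \<and> realizable t l r)"
proof
  assume "tot_bigraphic t d"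
  then obtain V :: "nat set" and E where E: "bipartite_multigraph V E" "TotMult E \<le> t"
      "image_mset (multi_degree E) (mset_set V) = mset d"
    unfolding tot_bigraphic_def degrees_on_def desc_list_eq_iff[OF assms] by blast
  then obtain A B where AB: "V = A \<union> B" "bipartite_with A B (set_mset E)"
    by (auto simp: bipartite_multigraph_def bipartite_def underlying_edges_def)
  then have "mset_set V = mset_set A + mset_set B"
    by (simp add: bipartite_with_def simple_graph_def mset_set_Union)
  then have "mset d = image_mset (multi_degree E) (mset_set A) + image_mset (multi_degree E) (mset_set B)"
    using E(3) by simp
  moreover have "realizable t (image_mset (multi_degree E) (mset_set A)) (image_mset (multi_degree E) (mset_set B))"
    using AB(2) E(2) unfolding realizable_iff_bipartite_with TotMult_def excess_def underlying_edges_def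
    by blast
  ultimately show "\<exists>l r. mset d = l + r \<and> realizable t l r"
    by blast
next
  assume "\<exists>l r. mset d = l + r \<and> realizable t l r"
  then obtain A B :: "nat set" and E where E: "bipartite_with A B (set_mset E)" "excess E \<le> t"
      "mset d = image_mset (multi_degree E) (mset_set A) + image_mset (multi_degree E) (mset_set B)"
    unfolding realizable_iff_bipartite_with by blast
  have "mset_set (A \<union> B) = mset_set A + mset_set B"
    using E(1) by (simp add: bipartite_with_def simple_graph_def mset_set_Union)
  then have "image_mset (multi_degree E) (mset_set (A \<union> B)) = mset d"
    using E(3) by simp
  moreover have "bipartite_multigraph (A \<union> B) E"
    using E(1) unfolding bipartite_multigraph_def bipartite_def underlying_edges_def multigraph_def
    by (metis bipartite_with_def simple_graph_def)
  ultimately show "tot_bigraphic t d"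
    unfolding tot_bigraphic_def degrees_on_def desc_list_eq_iff[OF assms]
    using E(2) unfolding TotMult_def excess_def underlying_edges_def by blast
qed

section \<open>Balanced partitions\<close>

lemma BP_pair_iff: "{a, b} \<in> BP d \<longleftrightarrow> block d a \<and> block d b \<and> a \<odot> b = d"
proof -
  have "a \<odot> b = b \<odot> a"
    by (simp add: seq_comp_def add.commute)
  then show ?thesis
    by (auto simp: BP_def doubleton_eq_iff)
qed

text \<open>Equal sums make each part half of the total, and sorting the parts turns them into
  subsequences of \<open>d\<close>.\<close>

lemma desc_list_pair_in_BP:
  assumes "sorted_wrt (\<ge>) d" "mset d = l + r" "sum_mset l = sum_mset r"
  shows "{desc_list l, desc_list r} \<in> BP d"
proof -
  have "sum_list d = sum_mset l + sum_mset r"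
    using assms(2) by (metis sum_mset_sum_list sum_mset.union)
  moreover have "sum_list (desc_list M) = sum_mset M" for M
    by (metis mset_desc_list sum_mset_sum_list)
  moreover have "subseq (desc_list l) d" "subseq (desc_list r) d"
    using assms(1,2) sorted_desc_list by (auto intro!: subseq_if_mset_subseteq_sorted)
  moreover have "desc_list l \<odot> desc_list r = d"
    using assms(1,2) by (simp add: seq_comp_def desc_list_eq_iff)
  ultimately show ?thesis
    using assms(3) by (simp add: BP_pair_iff block_def)
qed

theorem theorem10:
  fixes d :: "nat list" and t :: nat
  assumes "degree_sequence d" and "0 < t"
  shows "tot_bigraphic t d \<longleftrightarrow>
    (\<exists>a b. {a, b} \<in> BP d \<and> bigraphic (a \<odot> replicate t 1) (b \<odot> replicate t 1))"
proof -
  have sorted: "sorted_wrt (\<ge>) d"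
    using assms(1) by (simp add: degree_sequence_def)
  \<comment> \<open>The appended ones are traded for \<open>t\<close> units of allowed
    excess.\<close>
  have iff: "bigraphic (a \<odot> replicate t 1) (b \<odot> replicate t 1) \<longleftrightarrow> realizable t (mset a) (mset b)" for a b
    by (simp add: bigraphic_iff_realizable sorted_seq_comp realizable_iff_ones[of t])
  have "(\<exists>l r. mset d = l + r \<and> realizable t l r) \<longleftrightarrow>
      (\<exists>a b. {a, b} \<in> BP d \<and> realizable t (mset a) (mset b))"
  proof
    assume "\<exists>l r. mset d = l + r \<and> realizable t l r"
    then obtain l r where lr: "mset d = l + r" "realizable t l r"
      by blast
    then show "\<exists>a b. {a, b} \<in> BP d \<and> realizable t (mset a) (mset b)"
      \<comment> \<open>The balance of the split comes from counting edge copies on both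
        sides.\<close>
      using desc_list_pair_in_BP[OF sorted lr(1) realizable_sums_eq[OF lr(2)]]
      by (metis mset_desc_list)
  next
    assume "\<exists>a b. {a, b} \<in> BP d \<and> realizable t (mset a) (mset b)"
    then show "\<exists>l r. mset d = l + r \<and> realizable t l r"
      by (metis BP_pair_iff mset_seq_comp)
  qed
  then show ?thesis
    unfolding tot_bigraphic_iff_realizable[OF sorted] iff .
qed

end
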